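(* Let $\alpha_1,\dots,\alpha_N>0$ satisfy $\frac{2\alpha_j}{\alpha_{j-1}}=\sqrt{(j-1)(N-j+1)}$ for $2\le j\le N$, and let $W(x)=e^{-x^2}L(x)L(x)^*$, $x\in\mathbb{R}$, where $L(x)_{j,k}=\frac{H_{j-k}(x)}{(j-k)!}\frac{\alpha_j}{\alpha_k}$ for $j\ge k$ and $L(x)_{j,k}=0$ for $j<k$. Let $A$ be the $N\times N$ matrix with $A_{j,j-1}=2\alpha_j/\alpha_{j-1}$ and all other entries zero, and $J=\mathrm{diag}(1,2,\dots,N)$. Then $W$ satisfies the Pearson equation $W'(x)=-W(x)V(x)$, where $V(x)$ is the polynomial of degree two given by $$-V(x)=(L(0)^* )^{-1}A\,L(0)^*+A^*+2x\left(J+\tfrac12(A^* )^2-\tfrac{N+3}{2}\right)-x^2A^* .$$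
   Context: $H_n$ are the standard (physicists') Hermite polynomials (leading coefficient $2^n$). Scalars in matrix expressions stand for scalar multiples of the identity matrix $I$.
   Formalization: The claim that V has degree exactly two is proved for N ≥ 2; for N = 1 one has A = 0 and V(x) = 2x, of degree one, so only degree at most two is claimed there. The Pearson equation is proved for all N ≥ 1. *)

theory Defs
  imports
    Complex_Main
    "HOL-Computational_Algebra.Polynomial"
    "Jordan_Normal_Form.Schur_Decomposition"
    "Jordan_Normal_Form.Gauss_Jordan_Elimination"
begin

fun hermite :: "nat \<Rightarrow> real poly" where
  "hermite 0 = 1"
| "hermite (Suc 0) = [:0, 2:]"
| "hermite (Suc (Suc n)) = [:0, 2:] * hermite (Suc n) - smult (2 * real (Suc n)) (hermite n)"

(* Physicists' normalization: leading coefficient 2^n, and Rodrigues' formula in the differential form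
   d/dx (H_n(x) exp(-x^2)) = - H_(n+1)(x) exp(-x^2). *)
lemma hermite_degree_lead_coeff:
  "degree (hermite n) = n \<and> lead_coeff (hermite n) = 2 ^ n"
proof (induction n rule: hermite.induct)
  case (3 n)
  have nz: "hermite (Suc n) \<noteq> 0" using "3.IH"(1) by auto
  let ?p = "[:0, 2:] * hermite (Suc n)" and ?q = "smult (2 * real (Suc n)) (hermite n)"
  have dp: "degree ?p = Suc (Suc n)"
    using "3.IH"(1) nz by (subst degree_mult_eq) auto
  have lp: "lead_coeff ?p = 2 ^ Suc (Suc n)"
    by (subst lead_coeff_mult) (simp only: conjunct2[OF "3.IH"(1)], simp)
  have dq: "degree ?q < degree ?p"
    using "3.IH"(2) dp by simp
  have "degree (?p - ?q) = degree ?p"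
    using dq degree_add_eq_left[of "- ?q" ?p] by simp
  moreover have "coeff ?q (Suc (Suc n)) = 0"
    using dq dp by (intro coeff_eq_0) simp
  ultimately show ?case using dp lp by simp
qed auto

lemma pderiv_hermite: "pderiv (hermite (Suc n)) = smult (2 * real (Suc n)) (hermite n)"
proof (induction n rule: less_induct)
  case (less n)
  show ?case
  proof (cases n)
    case 0
    then show ?thesis by (simp add: pderiv_pCons)
  next
    case (Suc m)
    have 1: "pderiv (hermite (Suc m)) = smult (2 * real (Suc m)) (hermite m)"
      using less Suc by simp
    have 2: "pderiv (hermite m) = smult (2 * real m) (hermite (m - 1))"
      using less[of "m - 1"] Suc by (cases m) (auto simp: pderiv_1)
    have "pderiv (hermite (Suc (Suc m))) = [:0, 2:] * pderiv (hermite (Suc m))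
        + smult 2 (hermite (Suc m)) - smult (2 * real (Suc m)) (pderiv (hermite m))"
      by (simp add: pderiv_diff pderiv_mult pderiv_smult pderiv_pCons algebra_simps)
    also have "\<dots> = smult (2 * real (Suc (Suc m))) (hermite (Suc m))"
    proof (rule poly_ext)
      fix x
      show "poly ([:0, 2:] * pderiv (hermite (Suc m))
        + smult 2 (hermite (Suc m)) - smult (2 * real (Suc m)) (pderiv (hermite m))) x
        = poly (smult (2 * real (Suc (Suc m))) (hermite (Suc m))) x"
        unfolding 1 2 by (cases m) (simp_all add: algebra_simps)
    qed
    finally show ?thesis using Suc by simp
  qed
qed

lemma hermite_Suc: "hermite (Suc n) = [:0, 2:] * hermite n - pderiv (hermite n)"
proof (cases n)
  case 0
  then show ?thesis by (simp add: pderiv_1)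
next
  case (Suc m)
  then show ?thesis by (simp add: pderiv_hermite)
qed

lemma hermite_Rodrigues:
  "((\<lambda>x. poly (hermite n) x * exp (- (x^2))) has_real_derivative
     - (poly (hermite (Suc n)) x * exp (- (x^2)))) (at x)"
  unfolding hermite_Suc by (auto intro!: derivative_eq_intros simp: algebra_simps)

(* Matrices are indexed from 0, so row i and column k below are the indices i + 1 and k + 1
   of the one-based mathematical notation; alpha keeps its one-based indexing. *)

definition L_mat :: "nat \<Rightarrow> (nat \<Rightarrow> real) \<Rightarrow> real \<Rightarrow> complex mat" where
  "L_mat N \<alpha> x = mat N N (\<lambda>(i, k). if k \<le> i
     then complex_of_real (poly (hermite (i - k)) x / fact (i - k) * (\<alpha> (i + 1) / \<alpha> (k + 1)))
     else 0)"

definition W_mat :: "nat \<Rightarrow> (nat \<Rightarrow> real) \<Rightarrow> real \<Rightarrow> complex mat" where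
  "W_mat N \<alpha> x = complex_of_real (exp (- (x^2))) \<cdot>\<^sub>m (L_mat N \<alpha> x * mat_adjoint (L_mat N \<alpha> x))"

definition A_mat :: "nat \<Rightarrow> (nat \<Rightarrow> real) \<Rightarrow> complex mat" where
  "A_mat N \<alpha> = mat N N (\<lambda>(i, k). if i = k + 1
     then complex_of_real (2 * \<alpha> (i + 1) / \<alpha> i) else 0)"

definition J_mat :: "nat \<Rightarrow> complex mat" where
  "J_mat N = mat_diag N (\<lambda>i. of_nat (i + 1))"

(* Only meaningful for invertible matrices. *)
definition mat_inv :: "complex mat \<Rightarrow> complex mat" where
  "mat_inv M = the (mat_inverse M)"

definition V_mat :: "nat \<Rightarrow> (nat \<Rightarrow> real) \<Rightarrow> real \<Rightarrow> complex mat" where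
  "V_mat N \<alpha> x =
     (let A = A_mat N \<alpha>; A' = mat_adjoint A; L0' = mat_adjoint (L_mat N \<alpha> 0) in
      - (mat_inv L0' * A * L0' + A'
         + complex_of_real (2 * x) \<cdot>\<^sub>m
             (J_mat N + (1/2) \<cdot>\<^sub>m (A' ^\<^sub>m 2) - (of_nat (N + 3) / 2) \<cdot>\<^sub>m 1\<^sub>m N)
         - complex_of_real (x^2) \<cdot>\<^sub>m A'))"

definition has_mat_derivative :: "(real \<Rightarrow> complex mat) \<Rightarrow> complex mat \<Rightarrow> real \<Rightarrow> bool" where
  "has_mat_derivative F D x \<longleftrightarrow>
     (\<forall>t. F t \<in> carrier_mat (dim_row D) (dim_col D)) \<and>
     (\<forall>i < dim_row D. \<forall>k < dim_col D.
        ((\<lambda>t. F t $$ (i, k)) has_vector_derivative D $$ (i, k)) (at x))"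

definition eval_mat_poly :: "complex poly mat \<Rightarrow> real \<Rightarrow> complex mat" where
  "eval_mat_poly P x = map_mat (\<lambda>p. poly p (complex_of_real x)) P"

definition mat_poly_degree :: "complex poly mat \<Rightarrow> nat" where
  "mat_poly_degree P = Max (degree ` elements_mat P)"

(* The inverse occurring in V_mat is the genuine two-sided one. *)
lemma mat_inv_adjoint_L_mat:
  fixes \<alpha> :: "nat \<Rightarrow> real" and x :: real
  assumes pos: "\<And>j. 1 \<le> j \<Longrightarrow> j \<le> N \<Longrightarrow> \<alpha> j > 0"
  shows "mat_inv (mat_adjoint (L_mat N \<alpha> x)) \<in> carrier_mat N N"
    "mat_adjoint (L_mat N \<alpha> x) * mat_inv (mat_adjoint (L_mat N \<alpha> x)) = 1\<^sub>m N"
    "mat_inv (mat_adjoint (L_mat N \<alpha> x)) * mat_adjoint (L_mat N \<alpha> x) = 1\<^sub>m N"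
proof -
  define L where "L = L_mat N \<alpha> x"
  define M where "M = mat_adjoint L"
  have dL: "dim_row L = N" "dim_col L = N"
    unfolding L_def L_mat_def by simp_all
  have M: "M \<in> carrier_mat N N"
    unfolding M_def mat_adjoint_def carrier_mat_def using dL by simp
  have entry: "M $$ (i, k) = conjugate (L $$ (k, i))" if "i < N" "k < N" for i k
    using that dL unfolding M_def mat_adjoint_def mat_of_rows_def by simp
  have zero: "L $$ (k, i) = 0" if "k < i" "i < N" for i k
    using that unfolding L_def L_mat_def by simp
  have one: "L $$ (i, i) = 1" if "i < N" for i
  proof -
    have "\<alpha> (i + 1) \<noteq> 0" using pos[of "i + 1"] that by simp
    then show ?thesis using that unfolding L_def L_mat_def by simp
  qed
  have ut: "upper_triangular M"
  proof (rule upper_triangularI)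
    fix i j assume "j < i" "i < dim_row M"
    then show "M $$ (i, j) = 0" using M entry[of i j] zero[of j i] by simp
  qed
  have "diag_mat M = map (\<lambda>i. 1) [0..<N]"
    unfolding diag_mat_def using M by (intro map_cong) (simp_all add: entry one)
  then have "prod_list (diag_mat M) = 1"
    by (simp add: map_replicate_const)
  then have "det M = 1"
    using det_upper_triangular[OF ut M] by simp
  then have "M \<in> Units (ring_mat TYPE(complex) N ())"
    using det_non_zero_imp_unit[OF M] by simp
  then obtain B where B: "mat_inverse M = Some B"
    using mat_inverse(1)[OF M, of "()"] by (cases "mat_inverse M") blast+
  have inv: "mat_inv M = B" unfolding mat_inv_def B by simp
  show "mat_inv (mat_adjoint (L_mat N \<alpha> x)) \<in> carrier_mat N N"
    "mat_adjoint (L_mat N \<alpha> x) * mat_inv (mat_adjoint (L_mat N \<alpha> x)) = 1\<^sub>m N"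
    "mat_inv (mat_adjoint (L_mat N \<alpha> x)) * mat_adjoint (L_mat N \<alpha> x) = 1\<^sub>m N"
    using mat_inverse(2)[OF M B] unfolding inv[symmetric] M_def L_def by blast+
qed

end

theory Submission
  imports Defs
begin

text \<open>
  Write \<open>L\<close>, \<open>A\<close> for the matrices of the theorem, \<open>B = A\<^sup>*\<close> and \<open>M(x) = L(x)\<^sup>*\<close>. The
  generating function of the Hermite polynomials says that \<open>M(x) = exp(x B - B\<^sup>2 / 4)\<close>, so that
  \<open>M' = M B\<close>, \<open>L' = L A\<close>, and
  \[ W' = e^{-x^2} (L A M + L M B - 2 x L M). \]
  If \<open>A M = M G\<close>, this is \<open>W (G + B - 2 x)\<close>. It remains to compute \<open>G = M\<^sup>-\<^sup>1 A M\<close>, and this is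
  where the condition on the \<open>\<alpha>\<^sub>j\<close> enters: it makes \<open>A\<close> and \<open>B\<close> the raising and lowering operators of
  the \<open>N\<close>-dimensional irreducible representation of \<open>sl\<^sub>2\<close>, that is, \<open>A B - B A = H\<close> with
  \<open>H = 2 J - (N + 1)\<close> and \<open>H B - B H = - 2 B\<close>. Hence the expansion of
  \<open>exp(-Y) A exp(Y)\<close> with \<open>Y = x B - B\<^sup>2 / 4\<close> into iterated commutators stops after the second one, and
  \[ G(x) = C + x (H + B^2) - x^2 B, \qquad C = A + (B - B H) / 2 - B^3 / 4. \]
  At \<open>x = 0\<close> this reads \<open>C = M(0)\<^sup>-\<^sup>1 A M(0)\<close>, and \<open>G + B - 2 x\<close> is exactly the polynomial \<open>-V\<close>.

  The formal proof verifies \<open>A M = M G\<close> directly instead of manipulating exponentials. The matrices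
  \<open>M B\<^sup>m\<close> have entries that depend, up to the weight \<open>\<alpha>\<^sub>k / \<alpha>\<^sub>i\<close>, only on the column \<open>k\<close> minus the
  row \<open>i\<close>, and right multiplication by \<open>B\<close> shifts this dependence by one
  (\<open>toeplitz_mult_adjoint_A\<close>). The entries of the identity thereby become a single scalar relation
  between the functions \<open>H\<^sub>n(x) / n!\<close> (\<open>hermite_fact_commutator\<close>), a consequence of the three-term
  recurrence.
\<close>

section \<open>Normalized Hermite polynomials\<close>

text \<open>
  Integer indices, with the value 0 at negative ones, make the recurrence and the derivative formula
  valid without exception; so the entries of a triangular matrix need no case distinction at the
  diagonal.
\<close>

definition hermite_fact :: "int \<Rightarrow> real \<Rightarrow> real" where
  "hermite_fact d x = (if d < 0 then 0 else poly (hermite (nat d)) x / fact (nat d))"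

lemma hermite_fact_neg: "d < 0 \<Longrightarrow> hermite_fact d x = 0"
  by (simp add: hermite_fact_def)

lemma hermite_fact_of_nat: "hermite_fact (int n) x = poly (hermite n) x / fact n"
  by (simp add: hermite_fact_def)

lemma hermite_fact_recurrence:
  "of_int d * hermite_fact d x = 2 * x * hermite_fact (d - 1) x - 2 * hermite_fact (d - 2) x"
proof (cases "d \<ge> 0")
  case False
  then show ?thesis by (simp add: hermite_fact_neg)
next
  case True
  then obtain n where d: "d = int n" using nonneg_int_cases by blast
  show ?thesis
  proof (cases n rule: hermite.cases)
    case 1
    then show ?thesis by (simp add: d hermite_fact_def)
  next
    case 2
    then show ?thesis by (simp add: d hermite_fact_def)
  next
    case (3 m)
    have e: "int n - 1 = int (Suc m)" "int n - 2 = int m" using 3 by simp_all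
    have "real (Suc (Suc m)) * (poly (hermite (Suc (Suc m))) x / fact (Suc (Suc m)))
        = poly (hermite (Suc (Suc m))) x / fact (Suc m)"
      unfolding fact_Suc[of "Suc m"] by (simp del: of_nat_Suc fact_Suc hermite.simps)
    also have "\<dots> = 2 * x * (poly (hermite (Suc m)) x / fact (Suc m)) - 2 * (poly (hermite m) x / fact m)"
      unfolding fact_Suc[of m] by (simp add: diff_divide_distrib del: of_nat_Suc fact_Suc)
    finally show ?thesis unfolding d e hermite_fact_of_nat using 3 by simp
  qed
qed

lemma hermite_fact_derivative:
  "(hermite_fact d has_real_derivative 2 * hermite_fact (d - 1) x) (at x)"
proof (cases "d > 0")
  case False
  then have "hermite_fact d = (\<lambda>x. if d < 0 then 0 else 1)"
    by (auto simp: hermite_fact_def fun_eq_iff)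
  with False show ?thesis by (simp add: hermite_fact_neg)
next
  case True
  define m where "m = nat (d - 1)"
  have d: "d = int (Suc m)" "d - 1 = int m" using True by (simp_all add: m_def)
  have f: "hermite_fact d = (\<lambda>x. poly (hermite (Suc m)) x / fact (Suc m))"
    unfolding d(1) hermite_fact_of_nat by simp
  have "(hermite_fact d has_real_derivative poly (pderiv (hermite (Suc m))) x / fact (Suc m)) (at x)"
    unfolding f by (intro DERIV_cdivide poly_DERIV)
  also have "poly (pderiv (hermite (Suc m))) x / fact (Suc m) = 2 * hermite_fact (d - 1) x"
    unfolding d(2) hermite_fact_of_nat pderiv_hermite fact_Suc
    by (simp del: of_nat_Suc)
  finally show ?thesis .
qed

text \<open>
  This is the entry of \<open>A M = M G\<close> on the diagonal at distance \<open>d\<close>, where \<open>k\<close> is the column counted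
  from 0 and \<open>n\<close> the size. The two quadratic factors are the entries of \<open>A B\<close> in row \<open>k - d\<close> and row
  \<open>k + 1\<close>. Their difference is divisible by \<open>d + 1\<close>, so the recurrence removes \<open>hermite_fact (d + 1)\<close>;
  two further uses of the recurrence, at \<open>d\<close> and \<open>d - 1\<close>, absorb the remaining factors \<open>d\<close>.
\<close>

lemma hermite_fact_commutator:
  fixes d :: int and k n x :: real
  shows "(k - d) * (n - (k - d)) / 2 * hermite_fact (d + 1) x
    = (k + 1) * (n - (k + 1)) / 2 * hermite_fact (d + 1) x
      + x * ((2 * k + 1 - n) * hermite_fact d x) - (2 * k + 1 - n) * hermite_fact (d - 1) x
      + hermite_fact (d - 1) x - 2 * x^2 * hermite_fact (d - 1) x
      + 4 * x * hermite_fact (d - 2) x - 2 * hermite_fact (d - 3) x"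
proof -
  have r: "(d + 1) * hermite_fact (d + 1) x = 2 * x * hermite_fact d x - 2 * hermite_fact (d - 1) x"
    "d * hermite_fact d x = 2 * x * hermite_fact (d - 1) x - 2 * hermite_fact (d - 2) x"
    "(d - 1) * hermite_fact (d - 1) x = 2 * x * hermite_fact (d - 2) x - 2 * hermite_fact (d - 3) x"
    using hermite_fact_recurrence[of "d + 1" x] hermite_fact_recurrence[of d x]
      hermite_fact_recurrence[of "d - 1" x] by simp_all
  have "(k - d) * (n - (k - d)) / 2 * hermite_fact (d + 1) x
      - (k + 1) * (n - (k + 1)) / 2 * hermite_fact (d + 1) x
    = (2 * k + 1 - n - d) / 2 * ((d + 1) * hermite_fact (d + 1) x)"
    by (simp add: field_simps power2_eq_square)
  also have "\<dots> = (2 * k + 1 - n) * (x * hermite_fact d x - hermite_fact (d - 1) x)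
      - x * (d * hermite_fact d x) + (d - 1) * hermite_fact (d - 1) x + hermite_fact (d - 1) x"
    unfolding r(1) by (simp add: field_simps)
  also have "\<dots> = (2 * k + 1 - n) * (x * hermite_fact d x - hermite_fact (d - 1) x)
      - x * (2 * x * hermite_fact (d - 1) x - 2 * hermite_fact (d - 2) x)
      + (2 * x * hermite_fact (d - 2) x - 2 * hermite_fact (d - 3) x) + hermite_fact (d - 1) x"
    unfolding r(2) r(3) ..
  finally show ?thesis by (simp add: algebra_simps power2_eq_square)
qed

section \<open>Adjoints and products with bidiagonal matrices\<close>

lemma mat_adjoint_index:
  "i < dim_col M \<Longrightarrow> k < dim_row M \<Longrightarrow> mat_adjoint M $$ (i, k) = conjugate (M $$ (k, i))"
  by (simp add: mat_adjoint_def mat_of_rows_def)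

lemma mat_adjoint_carrier:
  "M \<in> carrier_mat n m \<Longrightarrow> mat_adjoint M \<in> carrier_mat m n"
  by (auto simp: mat_adjoint_def)

lemma mult_superdiagonal_index:
  fixes X :: "'a :: comm_ring_1 mat"
  assumes "X \<in> carrier_mat n n" "i < n" "k < n"
  shows "(X * mat n n (\<lambda>(j, k). if k = j + 1 then b k else 0)) $$ (i, k)
    = (if k = 0 then 0 else X $$ (i, k - 1) * b k)"
proof -
  have "(X * mat n n (\<lambda>(j, k). if k = j + 1 then b k else 0)) $$ (i, k)
    = (\<Sum>j = 0..<n. X $$ (i, j) * (if k = j + 1 then b k else 0))"
    using assms by (auto simp: scalar_prod_def)
  also have "\<dots> = (\<Sum>j = 0..<n. if k - 1 = j then (if k = 0 then 0 else X $$ (i, k - 1) * b k) else 0)"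
    by (rule sum.cong) auto
  also have "\<dots> = (if k = 0 then 0 else X $$ (i, k - 1) * b k)"
    using assms by (subst sum.delta') auto
  finally show ?thesis .
qed

lemma mult_subdiagonal_index:
  fixes X :: "'a :: comm_ring_1 mat"
  assumes "X \<in> carrier_mat n n" "i < n" "k < n"
  shows "(X * mat n n (\<lambda>(j, k). if j = k + 1 then b j else 0)) $$ (i, k)
    = (if k + 1 < n then X $$ (i, k + 1) * b (k + 1) else 0)"
proof -
  have "(X * mat n n (\<lambda>(j, k). if j = k + 1 then b j else 0)) $$ (i, k)
    = (\<Sum>j = 0..<n. X $$ (i, j) * (if j = k + 1 then b j else 0))"
    using assms by (auto simp: scalar_prod_def)
  also have "\<dots> = (\<Sum>j = 0..<n. if k + 1 = j then X $$ (i, k + 1) * b (k + 1) else 0)"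
    by (rule sum.cong) auto
  also have "\<dots> = (if k + 1 < n then X $$ (i, k + 1) * b (k + 1) else 0)"
    by (subst sum.delta') auto
  finally show ?thesis .
qed

lemma subdiagonal_mult_index:
  fixes X :: "'a :: comm_ring_1 mat"
  assumes "X \<in> carrier_mat n n" "i < n" "k < n"
  shows "(mat n n (\<lambda>(i, j). if i = j + 1 then b i else 0) * X) $$ (i, k)
    = (if i = 0 then 0 else b i * X $$ (i - 1, k))"
proof -
  have "(mat n n (\<lambda>(i, j). if i = j + 1 then b i else 0) * X) $$ (i, k)
    = (\<Sum>j = 0..<n. (if i = j + 1 then b i else 0) * X $$ (j, k))"
    using assms by (auto simp: scalar_prod_def)
  also have "\<dots> = (\<Sum>j = 0..<n. if i - 1 = j then (if i = 0 then 0 else b i * X $$ (i - 1, k)) else 0)"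
    by (rule sum.cong) auto
  also have "\<dots> = (if i = 0 then 0 else b i * X $$ (i - 1, k))"
    using assms by (subst sum.delta') auto
  finally show ?thesis .
qed

section \<open>Differentiation and polynomial degree of matrices\<close>

lemma has_mat_derivative_carrier_iff:
  "D \<in> carrier_mat n m \<Longrightarrow> has_mat_derivative F D x \<longleftrightarrow> (\<forall>t. F t \<in> carrier_mat n m) \<and>
    (\<forall>i<n. \<forall>k<m. ((\<lambda>t. F t $$ (i, k)) has_vector_derivative D $$ (i, k)) (at x))"
  by (auto simp: has_mat_derivative_def)

lemma has_mat_derivative_mult:
  assumes F: "has_mat_derivative F F' x" "F' \<in> carrier_mat n m"
    and G: "has_mat_derivative G G' x" "G' \<in> carrier_mat m p"
  shows "has_mat_derivative (\<lambda>t. F t * G t) (F' * G x + F x * G') x"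
proof -
  have c: "F t \<in> carrier_mat n m" "G t \<in> carrier_mat m p" for t
    using F G unfolding has_mat_derivative_def by auto
  have "((\<lambda>t. (F t * G t) $$ (i, k)) has_vector_derivative (F' * G x + F x * G') $$ (i, k)) (at x)"
    if ik: "i < n" "k < p" for i k
  proof -
    have f: "((\<lambda>t. F t $$ (i, j)) has_vector_derivative F' $$ (i, j)) (at x)" if "j < m" for j
      using F that ik unfolding has_mat_derivative_def by auto
    have g: "((\<lambda>t. G t $$ (j, k)) has_vector_derivative G' $$ (j, k)) (at x)" if "j < m" for j
      using G that ik unfolding has_mat_derivative_def by auto
    have e: "(F t * G t) $$ (i, k) = (\<Sum>j = 0..<m. F t $$ (i, j) * G t $$ (j, k))" for t
      using c[of t] ik by (auto simp: scalar_prod_def)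
    have d: "(F' * G x + F x * G') $$ (i, k)
      = (\<Sum>j = 0..<m. F x $$ (i, j) * G' $$ (j, k) + F' $$ (i, j) * G x $$ (j, k))"
      using c[of x] F(2) G(2) ik by (auto simp: scalar_prod_def sum.distrib)
    show ?thesis unfolding e d
      by (intro has_vector_derivative_sum has_vector_derivative_mult f g) auto
  qed
  moreover have "F' * G x + F x * G' \<in> carrier_mat n p"
    using c F(2) G(2) by (metis add_carrier_mat mult_carrier_mat)
  moreover have "F t * G t \<in> carrier_mat n p" for t
    using c by (rule mult_carrier_mat)
  ultimately show ?thesis by (simp add: has_mat_derivative_carrier_iff)
qed

lemma has_mat_derivative_smult:
  assumes c: "(c has_real_derivative c') (at x)"
    and F: "has_mat_derivative F F' x" "F' \<in> carrier_mat n m"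
  shows "has_mat_derivative (\<lambda>t. complex_of_real (c t) \<cdot>\<^sub>m F t)
    (complex_of_real c' \<cdot>\<^sub>m F x + complex_of_real (c x) \<cdot>\<^sub>m F') x"
proof -
  have d: "F t \<in> carrier_mat n m" for t
    using F unfolding has_mat_derivative_def by auto
  have c': "((\<lambda>t. complex_of_real (c t)) has_vector_derivative complex_of_real c') (at x)"
    using c by (simp add: has_real_derivative_iff_has_vector_derivative has_vector_derivative_of_real)
  have "((\<lambda>t. (complex_of_real (c t) \<cdot>\<^sub>m F t) $$ (i, k)) has_vector_derivative
     (complex_of_real c' \<cdot>\<^sub>m F x + complex_of_real (c x) \<cdot>\<^sub>m F') $$ (i, k)) (at x)"
    if ik: "i < n" "k < m" for i k
  proof -
    have f: "((\<lambda>t. F t $$ (i, k)) has_vector_derivative F' $$ (i, k)) (at x)"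
      using F ik unfolding has_mat_derivative_def by auto
    have e: "(complex_of_real (c t) \<cdot>\<^sub>m F t) $$ (i, k) = complex_of_real (c t) * F t $$ (i, k)" for t
      using d[of t] ik by auto
    have "(complex_of_real c' \<cdot>\<^sub>m F x + complex_of_real (c x) \<cdot>\<^sub>m F') $$ (i, k)
      = complex_of_real (c x) * F' $$ (i, k) + complex_of_real c' * F x $$ (i, k)"
      using d[of x] F(2) ik by auto
    then show ?thesis unfolding e using has_vector_derivative_mult[OF c' f] by simp
  qed
  then show ?thesis using d F(2) unfolding has_mat_derivative_def by auto
qed

lemma finite_elements_mat: "finite (elements_mat M)"
  by (simp add: elements_mat_def)

lemma mat_poly_degree_le:
  assumes "P \<in> carrier_mat n m" "0 < n" "0 < m"
    and "\<And>i k. i < n \<Longrightarrow> k < m \<Longrightarrow> degree (P $$ (i, k)) \<le> d"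
  shows "mat_poly_degree P \<le> d"
proof -
  have "P $$ (0, 0) \<in> elements_mat P"
    by (rule elements_matI[OF assms(1-3) refl])
  then have "degree ` elements_mat P \<noteq> {}" by blast
  moreover have "degree p \<le> d" if "p \<in> elements_mat P" for p
    using elements_matD[OF that] assms(1,4) by auto
  ultimately show ?thesis
    unfolding mat_poly_degree_def by (simp add: finite_elements_mat)
qed

lemma degree_le_mat_poly_degree:
  assumes "P \<in> carrier_mat n m" "i < n" "k < m"
  shows "degree (P $$ (i, k)) \<le> mat_poly_degree P"
  unfolding mat_poly_degree_def using assms
  by (intro Max_ge imageI elements_matI) (auto simp: finite_elements_mat)

section \<open>The matrices of the Hermite weight\<close>

text \<open>
  A Toeplitz matrix with symbol \<open>f\<close> on the diagonals, conjugated by the diagonal matrix of the \<open>\<alpha>\<^sub>j\<close>.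
\<close>

definition weighted_toeplitz :: "nat \<Rightarrow> (nat \<Rightarrow> real) \<Rightarrow> (int \<Rightarrow> real) \<Rightarrow> complex mat" where
  "weighted_toeplitz N \<alpha> f =
     mat N N (\<lambda>(i, k). complex_of_real (f (int k - int i) * (\<alpha> (k + 1) / \<alpha> (i + 1))))"

lemma L_A_carriers:
  "weighted_toeplitz N \<alpha> f \<in> carrier_mat N N"
  "L_mat N \<alpha> x \<in> carrier_mat N N"
  "A_mat N \<alpha> \<in> carrier_mat N N"
  "mat_adjoint (L_mat N \<alpha> x) \<in> carrier_mat N N"
  "mat_adjoint (A_mat N \<alpha>) \<in> carrier_mat N N"
  "J_mat N \<in> carrier_mat N N"
  by (auto intro!: mat_adjoint_carrier simp: weighted_toeplitz_def L_mat_def A_mat_def J_mat_def)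

lemma L_mat_index:
  assumes "i < N" "k < N"
  shows "L_mat N \<alpha> x $$ (i, k)
    = complex_of_real (hermite_fact (int i - int k) x * (\<alpha> (i + 1) / \<alpha> (k + 1)))"
  using assms by (auto simp: L_mat_def hermite_fact_def nat_diff_distrib')

lemma adjoint_L_mat:
  "mat_adjoint (L_mat N \<alpha> x) = weighted_toeplitz N \<alpha> (\<lambda>d. hermite_fact d x)"
  using L_A_carriers(2)[of N \<alpha> x] L_A_carriers(4)[of N \<alpha> x]
  by (intro eq_matI) (auto simp: mat_adjoint_index L_mat_index weighted_toeplitz_def)

lemma A_mat_subdiagonal:
  "A_mat N \<alpha> = mat N N (\<lambda>(i, k). if i = k + 1 then complex_of_real (2 * \<alpha> (i + 1) / \<alpha> i) else 0)"
  by (simp add: A_mat_def)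

lemma adjoint_A_mat:
  "mat_adjoint (A_mat N \<alpha>)
     = mat N N (\<lambda>(i, k). if k = i + 1 then complex_of_real (2 * \<alpha> (k + 1) / \<alpha> k) else 0)"
  using L_A_carriers(3)[of N \<alpha>] L_A_carriers(5)[of N \<alpha>]
  by (intro eq_matI) (auto simp: mat_adjoint_index A_mat_def)

text \<open>
  Up to the conjugation by the \<open>\<alpha>\<^sub>j\<close>, \<open>A\<^sup>*\<close> is twice the nilpotent shift. An upper triangular symbol
  is required because in the first column the product is 0, whereas the shifted symbol would bring in
  values at negative arguments.
\<close>

lemma toeplitz_mult_adjoint_A:
  assumes pos: "\<And>j. 1 \<le> j \<Longrightarrow> j \<le> N \<Longrightarrow> \<alpha> j > 0"
    and f: "\<And>d. d < 0 \<Longrightarrow> f d = 0"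
  shows "weighted_toeplitz N \<alpha> f * mat_adjoint (A_mat N \<alpha>) = weighted_toeplitz N \<alpha> (\<lambda>d. 2 * f (d - 1))"
proof (rule eq_matI)
  fix i k assume "i < dim_row (weighted_toeplitz N \<alpha> (\<lambda>d. 2 * f (d - 1)))"
    "k < dim_col (weighted_toeplitz N \<alpha> (\<lambda>d. 2 * f (d - 1)))"
  then have ik: "i < N" "k < N" by (simp_all add: weighted_toeplitz_def)
  have "(weighted_toeplitz N \<alpha> f * mat_adjoint (A_mat N \<alpha>)) $$ (i, k)
    = (if k = 0 then 0 else weighted_toeplitz N \<alpha> f $$ (i, k - 1) * complex_of_real (2 * \<alpha> (k + 1) / \<alpha> k))"
    unfolding adjoint_A_mat using mult_superdiagonal_index[OF L_A_carriers(1) ik] .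
  also have "\<dots> = weighted_toeplitz N \<alpha> (\<lambda>d. 2 * f (d - 1)) $$ (i, k)"
  proof (cases k)
    case 0
    then show ?thesis using ik f[of "- int i - 1"] by (simp add: weighted_toeplitz_def)
  next
    case (Suc m)
    have "\<alpha> k > 0" using pos[of k] Suc ik by simp
    then show ?thesis using Suc ik by (simp add: weighted_toeplitz_def algebra_simps)
  qed
  finally show "(weighted_toeplitz N \<alpha> f * mat_adjoint (A_mat N \<alpha>)) $$ (i, k)
    = weighted_toeplitz N \<alpha> (\<lambda>d. 2 * f (d - 1)) $$ (i, k)" .
qed (simp_all add: weighted_toeplitz_def adjoint_A_mat)

text \<open>
  Since \<open>H\<^sub>n' = 2 n H\<^bsub>n-1\<^esub>\<close>, differentiation moves every entry of \<open>L\<close> to the adjacent diagonal, with a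
  factor 2, and so does multiplication by \<open>A\<close>.
\<close>

lemma has_mat_derivative_L:
  assumes pos: "\<And>j. 1 \<le> j \<Longrightarrow> j \<le> N \<Longrightarrow> \<alpha> j > 0"
  shows "has_mat_derivative (L_mat N \<alpha>) (L_mat N \<alpha> x * A_mat N \<alpha>) x"
proof -
  have "((\<lambda>t. L_mat N \<alpha> t $$ (i, k)) has_vector_derivative (L_mat N \<alpha> x * A_mat N \<alpha>) $$ (i, k)) (at x)"
    if ik: "i < N" "k < N" for i k
  proof -
    have "(L_mat N \<alpha> x * A_mat N \<alpha>) $$ (i, k)
      = (if k + 1 < N then L_mat N \<alpha> x $$ (i, k + 1) * complex_of_real (2 * \<alpha> (k + 1 + 1) / \<alpha> (k + 1)) else 0)"
      unfolding A_mat_subdiagonal using mult_subdiagonal_index[OF L_A_carriers(2) ik] .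
    also have "\<dots> = complex_of_real (2 * hermite_fact (int i - int k - 1) x * (\<alpha> (i + 1) / \<alpha> (k + 1)))"
    proof (cases "k + 1 < N")
      case True
      then have "\<alpha> (k + 2) > 0" using pos by simp
      with True ik show ?thesis by (simp add: L_mat_index algebra_simps)
    next
      case False
      then show ?thesis using ik by (simp add: hermite_fact_neg)
    qed
    finally have e: "(L_mat N \<alpha> x * A_mat N \<alpha>) $$ (i, k)
      = complex_of_real (2 * hermite_fact (int i - int k - 1) x * (\<alpha> (i + 1) / \<alpha> (k + 1)))" .
    show ?thesis unfolding e L_mat_index[OF ik]
      by (intro has_vector_derivative_of_real)
        (auto simp flip: has_real_derivative_iff_has_vector_derivative
           intro!: DERIV_cmult_right hermite_fact_derivative simp del: times_divide_eq_right)
  qed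
  then show ?thesis
    by (subst has_mat_derivative_carrier_iff[OF mult_carrier_mat[OF L_A_carriers(2,3)]])
      (simp add: L_A_carriers)
qed

lemma has_mat_derivative_adjoint_L:
  assumes pos: "\<And>j. 1 \<le> j \<Longrightarrow> j \<le> N \<Longrightarrow> \<alpha> j > 0"
  shows "has_mat_derivative (\<lambda>t. mat_adjoint (L_mat N \<alpha> t))
    (mat_adjoint (L_mat N \<alpha> x) * mat_adjoint (A_mat N \<alpha>)) x"
proof -
  have e: "mat_adjoint (L_mat N \<alpha> x) * mat_adjoint (A_mat N \<alpha>)
    = weighted_toeplitz N \<alpha> (\<lambda>d. 2 * hermite_fact (d - 1) x)"
    unfolding adjoint_L_mat by (rule toeplitz_mult_adjoint_A[where N = N and \<alpha> = \<alpha>, OF pos]) (auto simp: hermite_fact_neg)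
  have "((\<lambda>t. weighted_toeplitz N \<alpha> (\<lambda>d. hermite_fact d t) $$ (i, k)) has_vector_derivative
     weighted_toeplitz N \<alpha> (\<lambda>d. 2 * hermite_fact (d - 1) x) $$ (i, k)) (at x)"
    if ik: "i < N" "k < N" for i k
    unfolding weighted_toeplitz_def index_mat(1)[OF ik] prod.case
    by (intro has_vector_derivative_of_real)
      (auto simp flip: has_real_derivative_iff_has_vector_derivative
         intro!: DERIV_cmult_right hermite_fact_derivative simp del: times_divide_eq_right)
  then have "has_mat_derivative (\<lambda>t. weighted_toeplitz N \<alpha> (\<lambda>d. hermite_fact d t))
     (weighted_toeplitz N \<alpha> (\<lambda>d. 2 * hermite_fact (d - 1) x)) x"
    by (subst has_mat_derivative_carrier_iff[OF L_A_carriers(1)]) (simp add: L_A_carriers)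
  then show ?thesis unfolding e by (simp only: adjoint_L_mat)
qed


section \<open>Conjugation of \<open>A\<close> by the adjoint of \<open>L(x)\<close>\<close>

text \<open>
  The commutator of \<open>A\<close> and \<open>A\<^sup>*\<close> under the hypothesis on the \<open>\<alpha>\<^sub>j\<close>; it equals \<open>2 J - (N + 1)\<close>.
\<close>

definition sl2_weight_mat :: "nat \<Rightarrow> complex mat" where
  "sl2_weight_mat N = mat_diag N (\<lambda>k. complex_of_real (2 * real k + 1 - real N))"

text \<open>
  The expansion of \<open>exp(-Y) A exp(Y)\<close> into commutators for \<open>Y = - B\<^sup>2 / 4\<close>: the first commutator is
  \<open>(B - B H) / 2\<close>, half of the second is \<open>- B\<^sup>3 / 4\<close>, and the third vanishes.
\<close>

definition conjugated_A :: "nat \<Rightarrow> (nat \<Rightarrow> real) \<Rightarrow> complex mat" where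
  "conjugated_A N \<alpha> = (let A = A_mat N \<alpha>; B = mat_adjoint A in
     A + (1/2) \<cdot>\<^sub>m (B - B * sl2_weight_mat N) - (1/4) \<cdot>\<^sub>m (B * B * B))"

lemma sl2_carriers:
  "sl2_weight_mat N \<in> carrier_mat N N"
  "conjugated_A N \<alpha> \<in> carrier_mat N N"
  using L_A_carriers(3,5)[of N \<alpha>]
  by (auto simp: sl2_weight_mat_def conjugated_A_def Let_def)

text \<open>
  Left and right multiplication by \<open>A\<close> both shift the symbol in the direction opposite to \<open>A\<^sup>*\<close>. They
  leave behind the square of a ratio \<open>2 \<alpha>\<^sub>j / \<alpha>\<^bsub>j-1\<^esub>\<close>, which the hypothesis turns into a quadratic
  polynomial in the row or in the column; that these differ is the noncommutativity of \<open>A\<close> and \<open>A\<^sup>*\<close>.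
\<close>

lemma A_mult_toeplitz_index:
  assumes pos: "\<And>j. 1 \<le> j \<Longrightarrow> j \<le> N \<Longrightarrow> \<alpha> j > 0"
    and ratio: "\<And>j. 2 \<le> j \<Longrightarrow> j \<le> N \<Longrightarrow>
           2 * \<alpha> j / \<alpha> (j - 1) = sqrt ((real j - 1) * (real N - real j + 1))"
    and ik: "i < N" "k < N"
  shows "(A_mat N \<alpha> * weighted_toeplitz N \<alpha> f) $$ (i, k) = complex_of_real
     (real i * (real N - real i) / 2 * f (int k - int i + 1) * (\<alpha> (k + 1) / \<alpha> (i + 1)))"
proof -
  have e: "(A_mat N \<alpha> * weighted_toeplitz N \<alpha> f) $$ (i, k) =
    (if i = 0 then 0 else complex_of_real (2 * \<alpha> (i + 1) / \<alpha> i) * weighted_toeplitz N \<alpha> f $$ (i - 1, k))"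
    unfolding A_mat_subdiagonal by (rule subdiagonal_mult_index[OF L_A_carriers(1) ik])
  show ?thesis
  proof (cases "i = 0")
    case True
    then show ?thesis unfolding e by simp
  next
    case False
    have p: "\<alpha> i > 0" "\<alpha> (i + 1) > 0" using False ik pos by simp_all
    have "2 * \<alpha> (i + 1) / \<alpha> i = sqrt (real i * (real N - real i))"
      using ratio[of "i + 1"] False ik by simp
    then have s: "(2 * \<alpha> (i + 1) / \<alpha> i)^2 = real i * (real N - real i)"
      using ik by simp
    have "2 * \<alpha> (i + 1) / \<alpha> i * (f (int k - int i + 1) * (\<alpha> (k + 1) / \<alpha> i))
      = (2 * \<alpha> (i + 1) / \<alpha> i)^2 / 2 * f (int k - int i + 1) * (\<alpha> (k + 1) / \<alpha> (i + 1))"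
      using p by (simp add: field_simps power2_eq_square)
    also have "\<dots> = real i * (real N - real i) / 2 * f (int k - int i + 1) * (\<alpha> (k + 1) / \<alpha> (i + 1))"
      unfolding s ..
    finally have r: "2 * \<alpha> (i + 1) / \<alpha> i * (f (int k - int i + 1) * (\<alpha> (k + 1) / \<alpha> i))
      = real i * (real N - real i) / 2 * f (int k - int i + 1) * (\<alpha> (k + 1) / \<alpha> (i + 1))" .
    have j: "int k - int (i - 1) = int k - int i + 1" "i - 1 + 1 = i" using False by simp_all
    have "weighted_toeplitz N \<alpha> f $$ (i - 1, k)
      = complex_of_real (f (int k - int i + 1) * (\<alpha> (k + 1) / \<alpha> i))"
      unfolding weighted_toeplitz_def 
      by (subst index_mat(1), use ik in simp, use ik in simp, simp only: j prod.case)
    then show ?thesis unfolding e using False by (simp only: if_False r flip: of_real_mult)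
  qed
qed

lemma toeplitz_mult_A_index:
  assumes pos: "\<And>j. 1 \<le> j \<Longrightarrow> j \<le> N \<Longrightarrow> \<alpha> j > 0"
    and ratio: "\<And>j. 2 \<le> j \<Longrightarrow> j \<le> N \<Longrightarrow>
           2 * \<alpha> j / \<alpha> (j - 1) = sqrt ((real j - 1) * (real N - real j + 1))"
    and ik: "i < N" "k < N"
  shows "(weighted_toeplitz N \<alpha> f * A_mat N \<alpha>) $$ (i, k) = complex_of_real
     ((real k + 1) * (real N - (real k + 1)) / 2 * f (int k - int i + 1) * (\<alpha> (k + 1) / \<alpha> (i + 1)))"
proof -
  have e: "(weighted_toeplitz N \<alpha> f * A_mat N \<alpha>) $$ (i, k) =
    (if k + 1 < N then weighted_toeplitz N \<alpha> f $$ (i, k + 1)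
       * complex_of_real (2 * \<alpha> (k + 1 + 1) / \<alpha> (k + 1)) else 0)"
    unfolding A_mat_subdiagonal by (rule mult_subdiagonal_index[OF L_A_carriers(1) ik])
  show ?thesis
  proof (cases "k + 1 < N")
    case False
    then have "N = k + 1" using ik by simp
    then show ?thesis unfolding e by simp
  next
    case True
    have p: "\<alpha> (k + 1) > 0" "\<alpha> (i + 1) > 0" using ik pos by simp_all
    have "2 * \<alpha> (k + 1 + 1) / \<alpha> (k + 1) = sqrt ((real k + 1) * (real N - (real k + 1)))"
      using ratio[of "k + 2"] True by (simp add: algebra_simps)
    then have s: "(2 * \<alpha> (k + 1 + 1) / \<alpha> (k + 1))^2 = (real k + 1) * (real N - (real k + 1))"
      using True by simp
    have "f (int k - int i + 1) * (\<alpha> (k + 1 + 1) / \<alpha> (i + 1)) * (2 * \<alpha> (k + 1 + 1) / \<alpha> (k + 1))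
      = (2 * \<alpha> (k + 1 + 1) / \<alpha> (k + 1))^2 / 2 * f (int k - int i + 1) * (\<alpha> (k + 1) / \<alpha> (i + 1))"
      using p by (simp add: field_simps power2_eq_square)
    also have "\<dots> = (real k + 1) * (real N - (real k + 1)) / 2 * f (int k - int i + 1) * (\<alpha> (k + 1) / \<alpha> (i + 1))"
      unfolding s ..
    finally have r: "f (int k - int i + 1) * (\<alpha> (k + 1 + 1) / \<alpha> (i + 1)) * (2 * \<alpha> (k + 1 + 1) / \<alpha> (k + 1))
      = (real k + 1) * (real N - (real k + 1)) / 2 * f (int k - int i + 1) * (\<alpha> (k + 1) / \<alpha> (i + 1))" .
    have j: "int (k + 1) - int i = int k - int i + 1" by simp
    have "weighted_toeplitz N \<alpha> f $$ (i, k + 1)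
      = complex_of_real (f (int k - int i + 1) * (\<alpha> (k + 1 + 1) / \<alpha> (i + 1)))"
      unfolding weighted_toeplitz_def using ik True
      by (subst index_mat) (simp_all only: j prod.case)
    then show ?thesis unfolding e using True by (simp only: if_True r flip: of_real_mult)
  qed
qed

text \<open>
  The factor on the right is quadratic in \<open>x\<close> because the threefold commutator of \<open>A\<close> with \<open>A\<^sup>*\<close> is 0.
  Its coefficients need not be guessed: they are the commutators of \<open>A\<close> with the logarithm
  \<open>x B - B\<^sup>2 / 4\<close> of \<open>M\<close>, sorted by powers of \<open>x\<close>.
\<close>

lemma A_mult_adjoint_L:
  assumes pos: "\<And>j. 1 \<le> j \<Longrightarrow> j \<le> N \<Longrightarrow> \<alpha> j > 0"
    and ratio: "\<And>j. 2 \<le> j \<Longrightarrow> j \<le> N \<Longrightarrow>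
           2 * \<alpha> j / \<alpha> (j - 1) = sqrt ((real j - 1) * (real N - real j + 1))"
  defines "A \<equiv> A_mat N \<alpha>"
  defines "B \<equiv> mat_adjoint A"
  shows "A * mat_adjoint (L_mat N \<alpha> x) = mat_adjoint (L_mat N \<alpha> x) *
    (conjugated_A N \<alpha> + complex_of_real x \<cdot>\<^sub>m (sl2_weight_mat N + B * B) - complex_of_real (x^2) \<cdot>\<^sub>m B)"
proof -
  define M where "M = mat_adjoint (L_mat N \<alpha> x)"
  define H where "H = sl2_weight_mat N"
  let ?T = "\<lambda>c m. weighted_toeplitz N \<alpha> (\<lambda>d. c * hermite_fact (d - m) x)"
  have c[simp]: "A \<in> carrier_mat N N" "B \<in> carrier_mat N N" "M \<in> carrier_mat N N" "H \<in> carrier_mat N N"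
    "weighted_toeplitz N \<alpha> f \<in> carrier_mat N N" for f
    unfolding A_def B_def M_def H_def by (simp_all add: L_A_carriers sl2_carriers)
  have M: "M = weighted_toeplitz N \<alpha> (\<lambda>d. hermite_fact d x)"
    unfolding M_def by (rule adjoint_L_mat)
  have 1: "M * B = ?T 2 1"
    unfolding M B_def A_def
    by (subst toeplitz_mult_adjoint_A[where N = N and \<alpha> = \<alpha>, OF pos]) (auto simp: hermite_fact_neg)
  have 2: "?T 2 1 * B = ?T 4 2"
    unfolding B_def A_def
    by (subst toeplitz_mult_adjoint_A[where N = N and \<alpha> = \<alpha>, OF pos]) (auto simp: hermite_fact_neg)
  have 3: "?T 4 2 * B = ?T 8 3"
    unfolding B_def A_def
    by (subst toeplitz_mult_adjoint_A[where N = N and \<alpha> = \<alpha>, OF pos]) (auto simp: hermite_fact_neg)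
  \<comment> \<open>The distributive law below produces powers of \<open>B\<close> grouped to the right of \<open>M\<close>.\<close>
  have MBB: "M * (B * B) = ?T 4 2"
    using assoc_mult_mat[of M N N B N B N] 1 2 by simp
  have MBBB: "M * (B * B * B) = ?T 8 3"
    using assoc_mult_mat[of M N N "B * B" N B N] MBB 3 by simp
  have MBH: "M * (B * H) = ?T 2 1 * H"
    using assoc_mult_mat[of M N N B N H N] 1 by simp
  have "M * (conjugated_A N \<alpha> + complex_of_real x \<cdot>\<^sub>m (H + B * B) - complex_of_real (x^2) \<cdot>\<^sub>m B)
    = M * A + (1/2) \<cdot>\<^sub>m (?T 2 1 - ?T 2 1 * H) - (1/4) \<cdot>\<^sub>m ?T 8 3
       + complex_of_real x \<cdot>\<^sub>m (M * H + ?T 4 2) - complex_of_real (x^2) \<cdot>\<^sub>m ?T 2 1"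
    unfolding conjugated_A_def Let_def A_def[symmetric] B_def[symmetric] H_def[symmetric]
    by (simp add: mult_add_distrib_mat[of _ N N _ N] mult_minus_distrib_mat[of _ N N _ N]
        mult_smult_distrib[of _ N N _ N] 1 MBB MBBB MBH
        minus_carrier_mat[of _ N N] add_carrier_mat[of _ N N] mult_carrier_mat[of _ N N _ N]
        del: assoc_mult_mat)
  also have "\<dots> = A * M"
  proof (rule eq_matI)
    fix i k assume "i < dim_row (A * M)" "k < dim_col (A * M)"
    then have ik: "i < N" "k < N" using c(1,3) by auto
    define w where "w = \<alpha> (k + 1) / \<alpha> (i + 1)"
    define h where "h m = hermite_fact (int k - int i + m) x" for m
    have T: "?T a m $$ (i, k) = complex_of_real (a * h (- m) * w)" for a m
      using ik by (simp add: weighted_toeplitz_def w_def h_def)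
    have H: "(X * H) $$ (i, k) = X $$ (i, k) * complex_of_real (2 * real k + 1 - real N)"
      if "X \<in> carrier_mat N N" for X
      unfolding H_def sl2_weight_mat_def mat_diag_mult_right[OF that] using ik by simp
    have Mik: "M $$ (i, k) = complex_of_real (h 0 * w)"
      using T[of 1 0] by (simp add: M)
    have MA: "(M * A) $$ (i, k)
      = complex_of_real ((real k + 1) * (real N - (real k + 1)) / 2 * h 1 * w)"
      unfolding M A_def w_def h_def by (rule toeplitz_mult_A_index[OF pos ratio ik])
    have AM: "(A * M) $$ (i, k) = complex_of_real (real i * (real N - real i) / 2 * h 1 * w)"
      unfolding M A_def w_def h_def by (rule A_mult_toeplitz_index[OF pos ratio ik])
    have key: "real i * (real N - real i) / 2 * h 1 = (real k + 1) * (real N - (real k + 1)) / 2 * h 1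
      + x * ((2 * real k + 1 - real N) * h 0) - (2 * real k + 1 - real N) * h (-1)
      + h (-1) - 2 * x^2 * h (-1) + 4 * x * h (-2) - 2 * h (-3)"
      using hermite_fact_commutator[of "real k" "int k - int i" "real N" x] by (simp add: h_def)
    have "(M * A + (1/2) \<cdot>\<^sub>m (?T 2 1 - ?T 2 1 * H) - (1/4) \<cdot>\<^sub>m ?T 8 3
       + complex_of_real x \<cdot>\<^sub>m (M * H + ?T 4 2) - complex_of_real (x^2) \<cdot>\<^sub>m ?T 2 1) $$ (i, k)
      = (M * A) $$ (i, k) + (1/2) * (?T 2 1 $$ (i, k) - (?T 2 1 * H) $$ (i, k)) - (1/4) * ?T 8 3 $$ (i, k)
       + complex_of_real x * ((M * H) $$ (i, k) + ?T 4 2 $$ (i, k)) - complex_of_real (x^2) * ?T 2 1 $$ (i, k)"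
      using ik carrier_matD[OF c(1)] carrier_matD[OF c(3)] carrier_matD[OF c(4)] carrier_matD[OF c(5)]
      by (simp del: index_mult_mat(1))
    also have "\<dots> = complex_of_real (((real k + 1) * (real N - (real k + 1)) / 2 * h 1
      + x * ((2 * real k + 1 - real N) * h 0) - (2 * real k + 1 - real N) * h (-1)
      + h (-1) - 2 * x^2 * h (-1) + 4 * x * h (-2) - 2 * h (-3)) * w)"
      unfolding MA H[OF c(5)] H[OF c(3)] Mik T by (simp add: algebra_simps)
    also have "\<dots> = (A * M) $$ (i, k)"
      unfolding AM key[symmetric] ..
    finally show "(M * A + (1/2) \<cdot>\<^sub>m (?T 2 1 - ?T 2 1 * H) - (1/4) \<cdot>\<^sub>m ?T 8 3
       + complex_of_real x \<cdot>\<^sub>m (M * H + ?T 4 2) - complex_of_real (x^2) \<cdot>\<^sub>m ?T 2 1) $$ (i, k)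
      = (A * M) $$ (i, k)" .
  qed (use carrier_matD[OF c(1)] carrier_matD[OF c(3)] carrier_matD[OF c(4)] carrier_matD[OF c(5)] in simp_all)
  finally show ?thesis unfolding M_def H_def ..
qed

text \<open>
  The relation \<open>A M = M G\<close> at \<open>x = 0\<close>, where only the constant term of \<open>G\<close> survives.
\<close>

lemma conjugated_A_eq:
  assumes pos: "\<And>j. 1 \<le> j \<Longrightarrow> j \<le> N \<Longrightarrow> \<alpha> j > 0"
    and ratio: "\<And>j. 2 \<le> j \<Longrightarrow> j \<le> N \<Longrightarrow>
           2 * \<alpha> j / \<alpha> (j - 1) = sqrt ((real j - 1) * (real N - real j + 1))"
  defines "M \<equiv> mat_adjoint (L_mat N \<alpha> 0)"
  shows "mat_inv M * A_mat N \<alpha> * M = conjugated_A N \<alpha>"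
proof -
  let ?A = "A_mat N \<alpha>" and ?C = "conjugated_A N \<alpha>"
  let ?Z = "0 \<cdot>\<^sub>m (sl2_weight_mat N + mat_adjoint ?A * mat_adjoint ?A)"
  have c: "mat_inv M \<in> carrier_mat N N" "?A \<in> carrier_mat N N" "M \<in> carrier_mat N N"
    "?C \<in> carrier_mat N N" "mat_adjoint ?A \<in> carrier_mat N N" "sl2_weight_mat N \<in> carrier_mat N N"
    unfolding M_def using mat_inv_adjoint_L_mat(1)[where N = N and \<alpha> = \<alpha>, OF pos]
    by (simp_all add: L_A_carriers sl2_carriers)
  have "?C + ?Z - 0 \<cdot>\<^sub>m mat_adjoint ?A = ?C"
    using carrier_matD[OF c(4)] carrier_matD[OF c(5)] carrier_matD[OF c(6)]
    by (intro eq_matI) (simp_all del: index_mult_mat(1))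
  then have AM: "?A * M = M * ?C"
    using A_mult_adjoint_L[where N = N and \<alpha> = \<alpha>, OF pos ratio, of 0] unfolding M_def by simp
  have "mat_inv M * ?A * M = mat_inv M * (M * ?C)"
    using c AM by simp
  also have "\<dots> = mat_inv M * M * ?C" using c by simp
  also have "\<dots> = ?C"
    using mat_inv_adjoint_L_mat(3)[where N = N and \<alpha> = \<alpha> and x = 0, OF pos] c unfolding M_def by simp
  finally show ?thesis .
qed

section \<open>The Pearson equation\<close>

text \<open>
  The terms \<open>2 x J\<close> and \<open>- (N + 3) x\<close> in \<open>-V\<close> combine to \<open>x H - 2 x\<close>, where the summand \<open>- 2 x\<close> is the
  logarithmic derivative of the scalar weight.
\<close>

lemma V_mat_eq:
  assumes pos: "\<And>j. 1 \<le> j \<Longrightarrow> j \<le> N \<Longrightarrow> \<alpha> j > 0"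
    and ratio: "\<And>j. 2 \<le> j \<Longrightarrow> j \<le> N \<Longrightarrow>
           2 * \<alpha> j / \<alpha> (j - 1) = sqrt ((real j - 1) * (real N - real j + 1))"
  defines "B \<equiv> mat_adjoint (A_mat N \<alpha>)"
  shows "V_mat N \<alpha> x = complex_of_real (2 * x) \<cdot>\<^sub>m 1\<^sub>m N
    - (conjugated_A N \<alpha> + complex_of_real x \<cdot>\<^sub>m (sl2_weight_mat N + B * B) - complex_of_real (x^2) \<cdot>\<^sub>m B) - B"
    (is "_ = ?V")
proof -
  define C where "C = conjugated_A N \<alpha>"
  have c: "B \<in> carrier_mat N N" "C \<in> carrier_mat N N"
    unfolding B_def C_def by (simp_all add: L_A_carriers sl2_carriers)
  have C0: "mat_inv (mat_adjoint (L_mat N \<alpha> 0)) * A_mat N \<alpha> * mat_adjoint (L_mat N \<alpha> 0) = C"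
    unfolding C_def by (rule conjugated_A_eq[OF pos ratio])
  show ?thesis
  proof (rule eq_matI)
    fix i k assume "i < dim_row ?V" "k < dim_col ?V"
    then have ik: "i < N" "k < N" using carrier_matD[OF c(1)] by simp_all
    show "V_mat N \<alpha> x $$ (i, k) = ?V $$ (i, k)"
      unfolding V_mat_def Let_def C0 B_def[symmetric] C_def[symmetric] J_mat_def sl2_weight_mat_def
      using ik carrier_matD[OF c(1)] carrier_matD[OF c(2)]
      by (simp add: mat_diag_def numeral_2_eq_2 algebra_simps add_divide_distrib del: index_mult_mat(1))
  qed (use carrier_matD[OF c(1)] carrier_matD[OF c(2)] in \<open>simp_all add: V_mat_def Let_def B_def\<close>)
qed

lemma adjoint_L_mult_V:
  fixes x :: real
  assumes pos: "\<And>j. 1 \<le> j \<Longrightarrow> j \<le> N \<Longrightarrow> \<alpha> j > 0"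
    and ratio: "\<And>j. 2 \<le> j \<Longrightarrow> j \<le> N \<Longrightarrow>
           2 * \<alpha> j / \<alpha> (j - 1) = sqrt ((real j - 1) * (real N - real j + 1))"
  defines "A \<equiv> A_mat N \<alpha>" and "M \<equiv> mat_adjoint (L_mat N \<alpha> x)"
  shows "M * V_mat N \<alpha> x = complex_of_real (2 * x) \<cdot>\<^sub>m M - A * M - M * mat_adjoint A"
proof -
  define B where "B = mat_adjoint A"
  define G where "G = conjugated_A N \<alpha> + complex_of_real x \<cdot>\<^sub>m (sl2_weight_mat N + B * B)
    - complex_of_real (x^2) \<cdot>\<^sub>m B"
  have c: "B \<in> carrier_mat N N" "M \<in> carrier_mat N N" "G \<in> carrier_mat N N"
    unfolding A_def B_def M_def G_def
    by (simp_all add: L_A_carriers sl2_carriers minus_carrier_mat)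
  have V: "V_mat N \<alpha> x = complex_of_real (2 * x) \<cdot>\<^sub>m 1\<^sub>m N - G - B"
    unfolding G_def B_def A_def by (rule V_mat_eq[OF pos ratio])
  have AM: "A * M = M * G"
    unfolding A_def M_def G_def B_def by (rule A_mult_adjoint_L[OF pos ratio])
  have "M * V_mat N \<alpha> x = complex_of_real (2 * x) \<cdot>\<^sub>m M - M * G - M * B"
    unfolding V using c
    by (simp add: mult_minus_distrib_mat[of _ N N _ N] mult_smult_distrib[of _ N N _ N]
        minus_carrier_mat[of _ N N])
  then show ?thesis unfolding AM B_def .
qed

lemma W_mat_Pearson:
  assumes pos: "\<And>j. 1 \<le> j \<Longrightarrow> j \<le> N \<Longrightarrow> \<alpha> j > 0"
    and ratio: "\<And>j. 2 \<le> j \<Longrightarrow> j \<le> N \<Longrightarrow>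
           2 * \<alpha> j / \<alpha> (j - 1) = sqrt ((real j - 1) * (real N - real j + 1))"
  shows "has_mat_derivative (W_mat N \<alpha>) (- (W_mat N \<alpha> x * V_mat N \<alpha> x)) x"
proof -
  define A where "A = A_mat N \<alpha>"
  define B where "B = mat_adjoint A"
  define L where "L = L_mat N \<alpha> x"
  define M where "M = mat_adjoint L"
  define V where "V = V_mat N \<alpha> x"
  define e where "e = exp (- (x^2))"
  have V: "V \<in> carrier_mat N N"
    unfolding V_def V_mat_def Let_def
    by (simp add: L_A_carriers minus_carrier_mat uminus_carrier_mat)
  have c: "A \<in> carrier_mat N N" "B \<in> carrier_mat N N" "L \<in> carrier_mat N N" "M \<in> carrier_mat N N"
    unfolding A_def B_def L_def M_def by (simp_all add: L_A_carriers)
  have D: "has_mat_derivative (W_mat N \<alpha>) (complex_of_real (- 2 * x * e) \<cdot>\<^sub>m (L * M)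
      + complex_of_real e \<cdot>\<^sub>m (L * A * M + L * (M * B))) x"
    unfolding W_mat_def[abs_def] L_def M_def A_def B_def e_def
  proof (rule has_mat_derivative_smult[where n = N and m = N])
    show "((\<lambda>x. exp (- x\<^sup>2)) has_real_derivative - 2 * x * exp (- x\<^sup>2)) (at x)"
      by (auto intro!: derivative_eq_intros)
    show "has_mat_derivative (\<lambda>t. L_mat N \<alpha> t * mat_adjoint (L_mat N \<alpha> t))
      (L_mat N \<alpha> x * A_mat N \<alpha> * mat_adjoint (L_mat N \<alpha> x)
        + L_mat N \<alpha> x * (mat_adjoint (L_mat N \<alpha> x) * mat_adjoint (A_mat N \<alpha>))) x"
      by (rule has_mat_derivative_mult[OF has_mat_derivative_L[OF pos] mult_carrier_mat[OF L_A_carriers(2,3)]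
          has_mat_derivative_adjoint_L[OF pos] mult_carrier_mat[OF L_A_carriers(4,5)]])
  qed (use c in \<open>simp add: L_def M_def A_def B_def\<close>)
  have "- (W_mat N \<alpha> x * V) = - (complex_of_real e \<cdot>\<^sub>m (L * (M * V)))"
    unfolding W_mat_def L_def[symmetric] M_def[symmetric] e_def[symmetric]
    using c V by (simp add: mult_smult_assoc_mat[of _ N N _ N] assoc_mult_mat[of _ N N _ N _ N])
  also have "M * V = complex_of_real (2 * x) \<cdot>\<^sub>m M - A * M - M * B"
    unfolding V_def M_def L_def A_def B_def by (rule adjoint_L_mult_V[OF pos ratio])
  also have "L * \<dots> = complex_of_real (2 * x) \<cdot>\<^sub>m (L * M) - L * A * M - L * (M * B)"
    using c by (simp add: mult_minus_distrib_mat[of _ N N _ N] mult_smult_distrib[of _ N N _ N]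
        minus_carrier_mat[of _ N N] assoc_mult_mat[of _ N N _ N _ N] mult_carrier_mat[of _ N N _ N])
  also have "- (complex_of_real e \<cdot>\<^sub>m \<dots>) = complex_of_real (- 2 * x * e) \<cdot>\<^sub>m (L * M)
      + complex_of_real e \<cdot>\<^sub>m (L * A * M + L * (M * B))"
    using carrier_matD[OF c(1)] carrier_matD[OF c(2)] carrier_matD[OF c(3)] carrier_matD[OF c(4)]
    by (intro eq_matI) (simp_all add: algebra_simps del: index_mult_mat(1) assoc_mult_mat)
  finally show ?thesis using D unfolding V_def by simp
qed

text \<open>
  The coefficient of \<open>x\<^sup>2\<close> in \<open>V\<close> is \<open>A\<^sup>*\<close>, whose entries just above the diagonal are positive. For
  \<open>N = 1\<close> there are none, and \<open>V(x) = 2 x\<close>.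
\<close>

lemma V_mat_quadratic:
  assumes N: "N \<ge> 1"
    and pos: "\<And>j. 1 \<le> j \<Longrightarrow> j \<le> N \<Longrightarrow> \<alpha> j > 0"
    and ratio: "\<And>j. 2 \<le> j \<Longrightarrow> j \<le> N \<Longrightarrow>
           2 * \<alpha> j / \<alpha> (j - 1) = sqrt ((real j - 1) * (real N - real j + 1))"
  shows "\<exists>P \<in> carrier_mat N N. (\<forall>x. V_mat N \<alpha> x = eval_mat_poly P x)
          \<and> mat_poly_degree P \<le> 2 \<and> (N \<ge> 2 \<longrightarrow> mat_poly_degree P = 2)"
proof -
  define B where "B = mat_adjoint (A_mat N \<alpha>)"
  define C where "C = conjugated_A N \<alpha>"
  define K where "K = sl2_weight_mat N + B * B"
  have c: "B \<in> carrier_mat N N" "C \<in> carrier_mat N N" "K \<in> carrier_mat N N"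
    unfolding B_def C_def K_def
    by (simp_all add: L_A_carriers sl2_carriers mult_carrier_mat[of _ N N _ N])
  define P where "P = mat N N (\<lambda>(i, k). [: - C $$ (i, k) - B $$ (i, k),
    2 * 1\<^sub>m N $$ (i, k) - K $$ (i, k), B $$ (i, k) :])"
  have P: "P \<in> carrier_mat N N" unfolding P_def by simp
  have V: "V_mat N \<alpha> x = complex_of_real (2 * x) \<cdot>\<^sub>m 1\<^sub>m N
    - (C + complex_of_real x \<cdot>\<^sub>m K - complex_of_real (x^2) \<cdot>\<^sub>m B) - B" for x
    unfolding B_def C_def K_def by (rule V_mat_eq[OF pos ratio])
  have "V_mat N \<alpha> x = eval_mat_poly P x" for x
    unfolding V eval_mat_poly_def P_def
    using carrier_matD[OF c(1)] carrier_matD[OF c(2)] carrier_matD[OF c(3)]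
    by (intro eq_matI) (simp_all add: algebra_simps power2_eq_square)
  moreover have le: "mat_poly_degree P \<le> 2"
    using N by (intro mat_poly_degree_le[OF P]) (auto simp: P_def)
  moreover have "mat_poly_degree P = 2" if "N \<ge> 2"
  proof -
    have "B $$ (0, 1) = complex_of_real (2 * \<alpha> 2 / \<alpha> 1)"
      unfolding B_def adjoint_A_mat using that by (simp add: numeral_2_eq_2)
    moreover have "\<alpha> 2 > 0" "\<alpha> 1 > 0" using pos that by simp_all
    ultimately have "degree (P $$ (0, 1)) = 2"
      using that by (simp add: P_def)
    then show ?thesis
      using le degree_le_mat_poly_degree[OF P, of 0 1] that by simp
  qed
  ultimately show ?thesis using P by blast
qed

theorem proposition6p2:
  fixes N :: nat and \<alpha> :: "nat \<Rightarrow> real"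
  assumes "N \<ge> 1"
    and "\<And>j. 1 \<le> j \<Longrightarrow> j \<le> N \<Longrightarrow> \<alpha> j > 0"
    and "\<And>j. 2 \<le> j \<Longrightarrow> j \<le> N \<Longrightarrow>
           2 * \<alpha> j / \<alpha> (j - 1) = sqrt ((real j - 1) * (real N - real j + 1))"
  shows "(\<forall>x. has_mat_derivative (W_mat N \<alpha>) (- (W_mat N \<alpha> x * V_mat N \<alpha> x)) x)
    \<and> (\<exists>P \<in> carrier_mat N N. (\<forall>x. V_mat N \<alpha> x = eval_mat_poly P x)
          \<and> mat_poly_degree P \<le> 2 \<and> (N \<ge> 2 \<longrightarrow> mat_poly_degree P = 2))"
  using W_mat_Pearson[OF assms(2,3)] V_mat_quadratic[OF assms] by blast

end
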